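(* Let $T>0$, $I=[0,T]$, $q\in(0,1]$, let $\mathcal{H}_1,\mathcal{H}_2$ be real Hilbert spaces, let $\Omega\subset\mathcal{H}_2$ be nonempty, closed and convex, let $K:\Omega\to 2^{\Omega}$ be a set-valued mapping with nonempty closed convex values, let $f:I\times\mathcal{H}_1\to\mathcal{H}_1$, $g:I\times\mathcal{H}_1\times\mathcal{H}_2\to\mathcal{H}_1$, $G:I\times\mathcal{H}_1\times\Omega\to\mathcal{H}_2$, $\psi:C(I,\mathcal{H}_1)\to\mathcal{H}_1$, and $x_0\in\mathcal{H}_1$. Assume: (1) there are constants $l_G,\eta_G>0$ such that $\|G(s_2,x_2,u_2)-G(s_1,x_1,u_1)\|\le l_G(|s_2-s_1|+\|x_2-x_1\|+\|u_2-u_1\|)$ for all $s_1,s_2\in I$, $x_1,x_2\in\mathcal{H}_1$, $u_1,u_2\in\Omega$, and, for all $s\in I$, $x\in\mathcal{H}_1$, $u\in\Omega$ and $u_1,u_2\in K(u)$, $\langle G(s,x,u_2),u_1-u_2\rangle\ge 0$ implies $\langle G(s,x,u_1),u_1-u_2\rangle\ge\eta_G\|u_1-u_2\|^2$; (2) there is $l_K\ge 0$ such that $\|P_{K(u_2)}[\varpi]-P_{K(u_1)}[\varpi]\|\le l_K\|u_2-u_1\|$ for all $u_1,u_2\in\Omega$, $\varpi\in\mathcal{H}_2$; (3) $g$ is continuous and there is $l_g>0$ with $\|g(s,x_2,u_2)-g(s,x_1,u_1)\|\le l_g(\|x_2-x_1\|+\|u_2-u_1\|)$ for all $s\in I$,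 $x_1,x_2\in\mathcal{H}_1$, $u_1,u_2\in\mathcal{H}_2$; (4) $f$ is continuous and there is $l_f>0$ with $\|f(s,x_2)-f(s,x_1)\|\le l_f\|x_2-x_1\|$ for all $s\in I$, $x_1,x_2\in\mathcal{H}_1$; (5) $\psi$ is continuous and there is $0<l_\psi<1$ with $\|\psi(y_2)-\psi(y_1)\|\le l_\psi\|y_2-y_1\|_{\mathcal{B}}$ for all $y_1,y_2\in C(I,\mathcal{H}_1)$; (6) $2\dfrac{l_K^2}{\eta_G^2}\left(l_G\sqrt{4l_G^2+2\eta_G^2}+2l_G^2+\eta_G^2\right)<1$. Then the nonlocal fractional differential quasi-variational inequality (NFDQVI) $$\begin{cases}{}^{C}_{0}\mathrm{D}_s^{q}x(s)=f(s,x(s))+g(s,x(s),u(s)), & s\in I,\\ u(s)\in\mathrm{SOL}(K(\cdot),G(s,x(s),\cdot)), & s\in I,\\ x(0)=x_0+\psi(x)\end{cases}$$ is Mittag-Leffler-Hyers-Ulam stable with respect to $\mathrm{E}_q$.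
   Context: $P_C$ is the metric projection onto a nonempty closed convex set $C$. $C(I,Y)$ is the space of continuous functions $I\to Y$; $C(I,\mathcal{H}_1)$ is equipped with the Bielecki norm $\|x\|_{\mathcal{B}}=\max_{s\in I}e^{-\gamma s}\|x(s)\|$, where $\gamma>0$ is a given constant. ${}^{C}_{0}\mathrm{D}_s^{q}$ is the Caputo fractional derivative of order $q$. $\mathrm{E}_q(t)=\sum_{n=0}^\infty \frac{t^n}{\Gamma(nq+1)}$ is the Mittag-Leffler function. $\mathrm{SOL}(K(\cdot),G(s,z,\cdot))$ is the set of all $w\in\Omega$ with $w\in K(w)$ and $\langle G(s,z,w),v-w\rangle\ge 0$ for all $v\in K(w)$. By definition, $(x,u)\in C(I,\mathcal{H}_1)\times C(I,\Omega)$ is a solution of the NFDQVI if, for all $s\in I$, $x(s)=x_0+\psi(x)+\frac{1}{\Gamma(q)}\int_0^s(s-\zeta)^{q-1}[f(\zeta,x(\zeta))+g(\zeta,x(\zeta),u(\zeta))]\,d\zeta$ and $u(s)\in\mathrm{SOL}(K(\cdot),G(s,x(s),\cdot))$ (Bochner integrals). Mittag-Leffler-Hyers-Ulam stability with respect to $\mathrm{E}_q$ means: there exists $c>0$ such that for each $\varepsilon>0$ and each solution $(z,\upsilon)\in C(I,\mathcal{H}_1)\times C(I,\Omega)$ of the system $$\begin{cases}\left\|{}^{C}_{0}\mathrm{D}_s^{q}z(s)-f(s,z(s))-g(s,z(s),\upsilon(s))\right\|\le\varepsilon, & s\in I,\\ \upsilon(s)\in\mathrm{SOL}(K(\cdot),G(s,z(s),\cdot)),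 & s\in I,\\ z(0)=x(0),\end{cases}$$ where $x$ is the trajectory (first component) of a solution $(x,u)$ of the NFDQVI, there exists such a solution $(x,u)$ of the NFDQVI with $\|z(s)-x(s)\|\le c\,\varepsilon\,\mathrm{E}_q(s)$ for all $s\in I$. A pair $(z,\upsilon)$ solves this inequality system iff there is $h\in C(I,\mathcal{H}_1)$ with $\|h(s)\|\le\varepsilon$ for all $s\in I$, such that for all $s\in I$: $z(s)=z(0)+\frac{1}{\Gamma(q)}\int_0^s(s-\zeta)^{q-1}[f(\zeta,z(\zeta))+g(\zeta,z(\zeta),\upsilon(\zeta))+h(\zeta)]\,d\zeta$, $\upsilon(s)\in\mathrm{SOL}(K(\cdot),G(s,z(s),\cdot))$, and $z(0)=x(0)$. *)

theory Defs
  imports "HOL-Analysis.Analysis"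
begin

text \<open>
  The space \<open>C(I,Y)\<close>.  Its members are total functions whose values off \<open>I\<close> are irrelevant.  A map
  on \<open>C(I,Y)\<close> that is Lipschitz for a norm depending only on the values on \<open>I\<close> (such as the
  Bielecki norm below) automatically gives equal results on functions that agree on \<open>I\<close>.
\<close>

definition cont_maps :: "'a::topological_space set \<Rightarrow> 'b::topological_space set \<Rightarrow> ('a \<Rightarrow> 'b) set" where
  "cont_maps I Y = {x. continuous_on I x \<and> x ` I \<subseteq> Y}"

text \<open>For continuous \<open>x\<close> the supremum over the compact interval is a maximum.\<close>

definition bielecki_norm :: "real \<Rightarrow> real \<Rightarrow> (real \<Rightarrow> 'a::real_normed_vector) \<Rightarrow> real" where
  "bielecki_norm \<gamma> T x = (SUP s\<in>{0..T}. exp (- \<gamma> * s) * norm (x s))"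

text \<open>The library's \<^const>\<open>closest_point\<close> is restricted to Heine-Borel spaces.\<close>

definition metric_projection :: "'a::metric_space set \<Rightarrow> 'a \<Rightarrow> 'a" where
  "metric_projection C a = (THE p. p \<in> C \<and> (\<forall>y\<in>C. dist a p \<le> dist a y))"

definition mittag_leffler :: "real \<Rightarrow> real \<Rightarrow> real" where
  "mittag_leffler q t = (\<Sum>n. t ^ n / Gamma (real n * q + 1))"

text \<open>
  The library's \<^const>\<open>has_bochner_integral\<close> is restricted to second-countable (separable) target
  spaces.  The following is its definition, verbatim, for arbitrary normed spaces.
\<close>

definition has_bochner_integral_normed ::
    "'s measure \<Rightarrow> ('s \<Rightarrow> 'a::real_normed_vector) \<Rightarrow> 'a \<Rightarrow> bool" where
  "has_bochner_integral_normed M f J \<longleftrightarrow>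
     f \<in> borel_measurable M \<and>
     (\<exists>S. (\<forall>i. Bochner_Integration.simple_bochner_integrable M (S i)) \<and>
          (\<lambda>i. \<integral>\<^sup>+ y. ennreal (norm (f y - S i y)) \<partial>M) \<longlonglongrightarrow> 0 \<and>
          (\<lambda>i. Bochner_Integration.simple_bochner_integral M (S i)) \<longlonglongrightarrow> J)"

text \<open>
  The Riemann-Liouville integral: \<open>v\<close> equals \<open>1/\<Gamma>(q) \<integral>\<^sub>0\<^sup>s (s-\<zeta>)\<^bsup>q-1\<^esup> F(\<zeta>) d\<zeta>\<close>, the integral existing
  in the sense of Bochner.  At \<open>\<zeta> = s\<close> the kernel takes the value \<open>0 powr (q - 1) = 0\<close>, which only
  affects a null set.
\<close>

definition has_rl_integral ::
    "real \<Rightarrow> (real \<Rightarrow> 'a::real_normed_vector) \<Rightarrow> real \<Rightarrow> 'a \<Rightarrow> bool" where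
  "has_rl_integral q F s v \<longleftrightarrow>
     (\<exists>J. has_bochner_integral_normed lborel
            (\<lambda>\<zeta>. indicator {0..s} \<zeta> *\<^sub>R ((s - \<zeta>) powr (q - 1) *\<^sub>R F \<zeta>)) J \<and>
          v = (1 / Gamma q) *\<^sub>R J)"

definition SOL :: "'b::real_inner set \<Rightarrow> ('b \<Rightarrow> 'b set) \<Rightarrow> ('b \<Rightarrow> 'b) \<Rightarrow> 'b set" where
  "SOL \<Omega> K F = {w \<in> \<Omega>. w \<in> K w \<and> (\<forall>v\<in>K w. inner (F w) (v - w) \<ge> 0)}"

definition nfdqvi_solution ::
    "real \<Rightarrow> real \<Rightarrow> 'b::real_inner set \<Rightarrow> ('b \<Rightarrow> 'b set) \<Rightarrow>
     (real \<Rightarrow> 'a::real_inner \<Rightarrow> 'a) \<Rightarrow> (real \<Rightarrow> 'a \<Rightarrow> 'b \<Rightarrow> 'a) \<Rightarrow> (real \<Rightarrow> 'a \<Rightarrow> 'b \<Rightarrow> 'b) \<Rightarrow>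
     ((real \<Rightarrow> 'a) \<Rightarrow> 'a) \<Rightarrow> 'a \<Rightarrow> (real \<Rightarrow> 'a) \<Rightarrow> (real \<Rightarrow> 'b) \<Rightarrow> bool" where
  "nfdqvi_solution T q \<Omega> K f g G \<psi> x0 x u \<longleftrightarrow>
     x \<in> cont_maps {0..T} UNIV \<and> u \<in> cont_maps {0..T} \<Omega> \<and>
     (\<forall>s\<in>{0..T}.
        (\<exists>v. has_rl_integral q (\<lambda>\<zeta>. f \<zeta> (x \<zeta>) + g \<zeta> (x \<zeta>) (u \<zeta>)) s v \<and> x s = x0 + \<psi> x + v) \<and>
        u s \<in> SOL \<Omega> K (G s (x s)))"

text \<open>
  As for the equation itself, the Caputo derivative in the inequality
  \<open>\<parallel>D\<^sup>q z - f - g\<parallel> \<le> \<epsilon>\<close> is understood through the integral equation: \<open>z\<close> solves the equation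
  perturbed by some continuous \<open>h\<close> with \<open>\<parallel>h\<parallel> \<le> \<epsilon>\<close>.  The initial condition is \<open>z(0) = x(0)\<close>.
\<close>

definition nfdqvi_ineq_solution ::
    "real \<Rightarrow> real \<Rightarrow> 'b::real_inner set \<Rightarrow> ('b \<Rightarrow> 'b set) \<Rightarrow>
     (real \<Rightarrow> 'a::real_inner \<Rightarrow> 'a) \<Rightarrow> (real \<Rightarrow> 'a \<Rightarrow> 'b \<Rightarrow> 'a) \<Rightarrow> (real \<Rightarrow> 'a \<Rightarrow> 'b \<Rightarrow> 'b) \<Rightarrow>
     real \<Rightarrow> (real \<Rightarrow> 'a) \<Rightarrow> (real \<Rightarrow> 'a) \<Rightarrow> (real \<Rightarrow> 'b) \<Rightarrow> bool" where
  "nfdqvi_ineq_solution T q \<Omega> K f g G \<epsilon> x z \<upsilon> \<longleftrightarrow>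
     z \<in> cont_maps {0..T} UNIV \<and> \<upsilon> \<in> cont_maps {0..T} \<Omega> \<and>
     (\<exists>h \<in> cont_maps {0..T} UNIV.
        (\<forall>s\<in>{0..T}. norm (h s) \<le> \<epsilon>) \<and>
        (\<forall>s\<in>{0..T}. \<exists>v.
           has_rl_integral q (\<lambda>\<zeta>. f \<zeta> (z \<zeta>) + g \<zeta> (z \<zeta>) (\<upsilon> \<zeta>) + h \<zeta>) s v \<and> z s = z 0 + v)) \<and>
     (\<forall>s\<in>{0..T}. \<upsilon> s \<in> SOL \<Omega> K (G s (z s))) \<and>
     z 0 = x 0"

definition mlhu_stable ::
    "real \<Rightarrow> real \<Rightarrow> 'b::real_inner set \<Rightarrow> ('b \<Rightarrow> 'b set) \<Rightarrow>
     (real \<Rightarrow> 'a::real_inner \<Rightarrow> 'a) \<Rightarrow> (real \<Rightarrow> 'a \<Rightarrow> 'b \<Rightarrow> 'a) \<Rightarrow> (real \<Rightarrow> 'a \<Rightarrow> 'b \<Rightarrow> 'b) \<Rightarrow>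
     ((real \<Rightarrow> 'a) \<Rightarrow> 'a) \<Rightarrow> 'a \<Rightarrow> bool" where
  "mlhu_stable T q \<Omega> K f g G \<psi> x0 \<longleftrightarrow>
     (\<exists>c>0. \<forall>\<epsilon>>0. \<forall>z \<upsilon>.
        (\<exists>x u. nfdqvi_solution T q \<Omega> K f g G \<psi> x0 x u \<and>
               nfdqvi_ineq_solution T q \<Omega> K f g G \<epsilon> x z \<upsilon>) \<longrightarrow>
        (\<exists>x u. nfdqvi_solution T q \<Omega> K f g G \<psi> x0 x u \<and>
               nfdqvi_ineq_solution T q \<Omega> K f g G \<epsilon> x z \<upsilon> \<and>
               (\<forall>s\<in>{0..T}. norm (z s - x s) \<le> c * \<epsilon> * mittag_leffler q s)))"

end

theory Submission
  imports Defs
begin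

text \<open>
  No new solution has to be constructed: the solution \<open>(x, u)\<close> from which the perturbed pair
  \<open>(z, \<upsilon>)\<close> takes its initial value is itself close to \<open>(z, \<upsilon>)\<close>.  Since \<open>x\<close> and \<open>z\<close>
  start at the same point, the nonlocal term \<open>\<psi>\<close> cancels, and \<open>z - x\<close> is a Riemann-Liouville
  integral of the difference of the two right-hand sides.

  The controls are eliminated first.  A solution \<open>w\<close> of the quasi-variational inequality depends
  Lipschitz continuously on the state (\<open>SOL_lipschitz\<close>).  To compare solutions \<open>w\<^sub>1\<close> and \<open>w\<^sub>2\<close>
  that belong to different constraint sets, \<open>w\<^sub>1 - \<rho> F\<^sub>1(w\<^sub>1)\<close> is projected onto \<open>K w\<^sub>2\<close>: the result
  \<open>y\<close> is within \<open>l\<^sub>K \<parallel>w\<^sub>1 - w\<^sub>2\<parallel>\<close> of \<open>w\<^sub>1\<close>, lies in the same set as \<open>w\<^sub>2\<close>, and nearly solves the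
  inequality for \<open>F\<^sub>1\<close> there, with an error \<open>O(1/\<rho>)\<close>.  Pseudomonotonicity bounds \<open>\<parallel>y - w\<^sub>2\<parallel>\<close>, and
  \<open>\<rho> \<rightarrow> \<infinity>\<close> leaves the contraction factor \<open>l\<^sub>K (1 + l\<^sub>G/\<eta>\<^sub>G)\<close>, which the assumed smallness
  condition forces below 1.

  Hence \<open>d = z - x\<close> satisfies
  \<open>\<parallel>d(s)\<parallel> \<le> 1/\<Gamma>(q) \<integral>\<^sub>0\<^sup>s (s - \<zeta>)\<^bsup>q-1\<^esup> (M \<parallel>d(\<zeta>)\<parallel> + \<epsilon>) d\<zeta>\<close> with a constant \<open>M\<close>
  depending only on the data.  The fractional integral maps \<open>e\<^bsup>\<mu>\<zeta>\<^esup>\<close> below \<open>\<mu>\<^bsup>-q\<^esup> e\<^bsup>\<mu>s\<^esup>\<close>, so for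
  \<open>2M = \<mu>\<^bsup>q\<^esup>\<close> the maximum of \<open>e\<^bsup>-\<mu>s\<^esup> \<parallel>d(s)\<parallel>\<close> is at most half of itself plus \<open>\<epsilon>/(2M)\<close>
  (\<open>rl_integral_gronwall\<close>).  This gives a bound \<open>c \<epsilon>\<close>, and \<open>E\<^sub>q \<ge> 1\<close> on the half-line turns it
  into the required \<open>c \<epsilon> E\<^sub>q(s)\<close>.
\<close>

section \<open>The metric projection in a Hilbert space\<close>

text \<open>
  Points of \<open>C\<close> whose distance to \<open>a\<close> is nearly minimal are close to each other: by convexity their
  midpoint is no nearer to \<open>a\<close> than the minimum, and the parallelogram law does the rest.
  Completeness then provides a minimizer.
\<close>

lemma closest_point_exists_hilbert:
  fixes C :: "'b::{real_inner, banach} set"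
  assumes "C \<noteq> {}" "closed C" "convex C"
  shows "\<exists>p\<in>C. \<forall>y\<in>C. dist a p \<le> dist a y"
proof -
  define d where "d = infdist a C"
  define S where "S n = C \<inter> cball a (d + 1 / real (Suc n))" for n
  have d0: "d \<ge> 0" by (simp add: d_def infdist_nonneg)
  have d_le: "d \<le> dist a y" if "y \<in> C" for y using that by (simp add: d_def infdist_le)
  have mono: "S n \<subseteq> S m" if "m \<le> n" for m n
  proof -
    have "1 / real (Suc n) \<le> 1 / real (Suc m)" using that by (simp add: frac_le)
    then show ?thesis by (auto simp: S_def)
  qed
  have ne: "S n \<noteq> {}" for n
  proof -
    have "d < d + 1 / real (Suc n)" by simp
    then obtain y where "y \<in> C" "dist a y < d + 1 / real (Suc n)"
      unfolding d_def infdist_notempty[OF assms(1)]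
      by (subst (asm) cINF_less_iff) (use assms(1) in auto)
    then show ?thesis by (force simp: S_def)
  qed
  have sq: "(dist x y)\<^sup>2 \<le> 4 * ((2 * d + 1) * (1 / real (Suc n)))" if "x \<in> S n" "y \<in> S n" for x y n
  proof -
    define r where "r = 1 / real (Suc n)"
    have r: "0 \<le> r" "r \<le> 1" by (auto simp: r_def)
    have "(1/2) *\<^sub>R x + (1/2) *\<^sub>R y \<in> C"
      using that assms(3) by (auto simp: S_def convex_def)
    from d_le[OF this] have "d \<le> norm ((1/2) *\<^sub>R ((x - a) + (y - a)))"
      by (simp add: dist_norm norm_minus_commute algebra_simps flip: scaleR_add_left)
    then have "2 * d \<le> norm ((x - a) + (y - a))" by simp
    then have mid: "(2 * d)\<^sup>2 \<le> (norm ((x - a) + (y - a)))\<^sup>2" using d0 by (intro power_mono) auto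
    have "norm (x - a) \<le> d + r" "norm (y - a) \<le> d + r"
      using that by (auto simp: S_def r_def dist_norm norm_minus_commute)
    then have xy: "(norm (x - a))\<^sup>2 \<le> (d + r)\<^sup>2" "(norm (y - a))\<^sup>2 \<le> (d + r)\<^sup>2"
      by (auto intro: power_mono)
    have "(dist x y)\<^sup>2 = (norm ((x - a) - (y - a)))\<^sup>2" by (simp add: dist_norm)
    also have "\<dots> = 2 * (norm (x - a))\<^sup>2 + 2 * (norm (y - a))\<^sup>2 - (norm ((x - a) + (y - a)))\<^sup>2"
      by (simp add: power2_norm_eq_inner inner_add_left inner_add_right inner_diff_left
          inner_diff_right inner_commute algebra_simps)
    also have "\<dots> \<le> 4 * (d + r)\<^sup>2 - (2 * d)\<^sup>2" using mid xy by linarith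
    also have "\<dots> = 4 * (2 * d * r + r * r)" by (simp add: power2_eq_square algebra_simps)
    also have "\<dots> \<le> 4 * ((2 * d + 1) * r)"
      using r mult_left_le[of r r] by (simp add: algebra_simps)
    finally show ?thesis by (simp add: r_def)
  qed
  have small: "\<exists>n. \<forall>x\<in>S n. \<forall>y\<in>S n. dist x y < e" if "e > 0" for e
  proof -
    have "e\<^sup>2 / (4 * (2 * d + 1)) > 0" using that d0 by simp
    then obtain n where n: "1 / real (Suc n) < e\<^sup>2 / (4 * (2 * d + 1))"
      using reals_Archimedean[of "e\<^sup>2 / (4 * (2 * d + 1))"] by (auto simp: field_simps)
    have "4 * (2 * d + 1) * (1 / real (Suc n)) < e\<^sup>2"
      using n d0 by (simp add: pos_less_divide_eq mult.commute)
    then have "dist x y < e" if "x \<in> S n" "y \<in> S n" for x y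
      using sq[OF that] power_less_imp_less_base[of "dist x y" 2 e] \<open>e > 0\<close>
      by (simp add: mult.assoc)
    then show ?thesis by blast
  qed
  obtain p where p: "\<And>n. p \<in> S n"
    using decreasing_closed_nest[of S] ne mono small assms(2) by (auto simp: S_def)
  have "dist a p \<le> d"
  proof (rule field_le_epsilon)
    fix e :: real assume "e > 0"
    then obtain n where "1 / real (Suc n) < e" using nat_approx_posE by blast
    then show "dist a p \<le> d + e" using p[of n] by (auto simp: S_def)
  qed
  then show ?thesis using p[of 0] d_le by (force simp: S_def)
qed

lemma metric_projection_minimizes:
  fixes C :: "'b::{real_inner, banach} set"
  assumes "C \<noteq> {}" "closed C" "convex C"
  shows "metric_projection C a \<in> C \<and> (\<forall>y\<in>C. dist a (metric_projection C a) \<le> dist a y)"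
proof -
  have "\<exists>!p. p \<in> C \<and> (\<forall>y\<in>C. dist a p \<le> dist a y)"
    using closest_point_exists_hilbert[OF assms, of a] any_closest_point_unique[OF assms(3,2)]
    by metis
  from theI'[OF this] show ?thesis by (simp add: metric_projection_def)
qed

lemma metric_projection_dot:
  fixes C :: "'b::{real_inner, banach} set"
  assumes "C \<noteq> {}" "closed C" "convex C" "v \<in> C"
  shows "inner (a - metric_projection C a) (v - metric_projection C a) \<le> 0"
proof -
  note p = metric_projection_minimizes[OF assms(1-3), of a]
  show ?thesis
    by (rule any_closest_point_dot[OF assms(3,2) conjunct1[OF p] assms(4) conjunct2[OF p]])
qed

text \<open>
  A solution of a variational inequality over \<open>C\<close> is a fixed point of \<open>w \<mapsto> P\<^sub>C(w - \<rho> F)\<close>, \<open>F\<close> being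
  the value of the operator at the solution.
\<close>

lemma variational_inequality_imp_projection:
  fixes C :: "'b::{real_inner, banach} set"
  assumes C: "C \<noteq> {}" "closed C" "convex C" and w: "w \<in> C"
    and vi: "\<And>v. v \<in> C \<Longrightarrow> inner F (v - w) \<ge> 0" and \<rho>: "\<rho> \<ge> 0"
  shows "metric_projection C (w - \<rho> *\<^sub>R F) = w"
proof -
  define p where "p = metric_projection C (w - \<rho> *\<^sub>R F)"
  have "p \<in> C" using metric_projection_minimizes[OF C] by (simp add: p_def)
  then have "\<rho> * inner F (p - w) \<ge> 0" using vi \<rho> by simp
  moreover have "inner (w - \<rho> *\<^sub>R F - p) (w - p) \<le> 0"
    unfolding p_def by (rule metric_projection_dot[OF C w])
  ultimately have "inner (w - p) (w - p) \<le> 0"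
    by (simp add: inner_diff_left inner_diff_right algebra_simps)
  then have "inner (w - p) (w - p) = 0" using inner_ge_zero[of "w - p"] by linarith
  then show ?thesis by (simp add: p_def)
qed

section \<open>Lipschitz dependence of the quasi-variational inequality on its operator\<close>

text \<open>
  Pseudomonotonicity compares points of one constraint set only, so \<open>w\<^sub>1 \<in> K w\<^sub>1\<close> is first moved into
  \<open>K w\<^sub>2\<close>.  Projecting \<open>w\<^sub>1 - \<rho> F\<^sub>1(w\<^sub>1)\<close> instead of \<open>w\<^sub>1\<close> costs nothing, because its projection onto
  \<open>K w\<^sub>1\<close> is \<open>w\<^sub>1\<close> again, and makes the characterization of the projected point \<open>y\<close> say
  \<open>\<langle>F\<^sub>1(w\<^sub>1), y - w\<^sub>2\<rangle> \<le> \<langle>y - w\<^sub>1, w\<^sub>2 - y\<rangle> / \<rho>\<close>.  The number \<open>\<delta>\<close> measures how far the two operators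
  are apart.
\<close>

lemma SOL_lipschitz:
  fixes \<Omega> :: "'b::{real_inner, banach} set"
  assumes K: "\<And>u. u \<in> \<Omega> \<Longrightarrow> K u \<subseteq> \<Omega> \<and> K u \<noteq> {} \<and> closed (K u) \<and> convex (K u)"
    and w1: "w1 \<in> SOL \<Omega> K F1" and w2: "w2 \<in> SOL \<Omega> K F2"
    and F: "\<And>u. u \<in> \<Omega> \<Longrightarrow> norm (F2 u - F1 w1) \<le> l * (\<delta> + norm (u - w1))"
    and pos: "l \<ge> 0" "\<eta> > 0"
    and mono: "\<And>u1 u2. \<lbrakk>u1 \<in> K w2; u2 \<in> K w2; inner (F2 u2) (u1 - u2) \<ge> 0\<rbrakk> \<Longrightarrow>
         inner (F2 u1) (u1 - u2) \<ge> \<eta> * (norm (u1 - u2))\<^sup>2"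
    and P: "\<And>\<omega>. norm (metric_projection (K w2) \<omega> - metric_projection (K w1) \<omega>)
         \<le> k * norm (w2 - w1)"
  shows "(1 - k * (1 + l / \<eta>)) * norm (w1 - w2) \<le> l / \<eta> * \<delta>"
proof -
  define D where "D = k * norm (w2 - w1)"
  have w1': "w1 \<in> \<Omega>" "w1 \<in> K w1" "\<And>v. v \<in> K w1 \<Longrightarrow> inner (F1 w1) (v - w1) \<ge> 0"
    and w2': "w2 \<in> \<Omega>" "w2 \<in> K w2" "\<And>v. v \<in> K w2 \<Longrightarrow> inner (F2 w2) (v - w2) \<ge> 0"
    using w1 w2 by (auto simp: SOL_def)
  note K1 = K[OF w1'(1)] and K2 = K[OF w2'(1)]
  have D0: "D \<ge> 0" using P order_trans[OF norm_ge_zero] by (auto simp: D_def)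
  have main: "norm (w1 - w2) \<le> D + (l * (\<delta> + D) + D * e) / \<eta>" if e: "e > 0" for e
  proof -
    \<comment> \<open>the step length \<open>\<rho>\<close> is \<open>1/e\<close>\<close>
    define \<omega> where "\<omega> = w1 - (1 / e) *\<^sub>R F1 w1"
    define y where "y = metric_projection (K w2) \<omega>"
    have "metric_projection (K w1) \<omega> = w1"
      unfolding \<omega>_def using K1 w1' e by (intro variational_inequality_imp_projection) auto
    with P[of \<omega>] have yw1: "norm (y - w1) \<le> D" by (simp add: y_def D_def)
    have yK: "y \<in> K w2"
      using metric_projection_minimizes[of "K w2" \<omega>] K2 by (simp add: y_def)
    have "inner (\<omega> - y) (w2 - y) \<le> 0"
      unfolding y_def using K2 w2' by (intro metric_projection_dot) auto
    then have "inner (w1 - y) (w2 - y) \<le> (1 / e) * inner (F1 w1) (w2 - y)"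
      by (simp add: \<omega>_def inner_diff_left algebra_simps)
    then have F1: "inner (F1 w1) (y - w2) \<le> e * inner (y - w1) (w2 - y)"
      using e by (simp add: field_simps inner_diff_left inner_diff_right)
    also have "\<dots> \<le> e * (norm (y - w1) * norm (y - w2))"
      using e norm_cauchy_schwarz[of "y - w1" "w2 - y"]
      by (simp add: norm_minus_commute)
    also have "\<dots> \<le> e * (D * norm (y - w2))"
      using e yw1 by (intro mult_left_mono mult_right_mono) auto
    finally have F1: "inner (F1 w1) (y - w2) \<le> (D * e) * norm (y - w2)" by (simp add: ac_simps)
    have "norm (F2 y - F1 w1) \<le> l * (\<delta> + norm (y - w1))" using yK K2 by (intro F) auto
    also have "\<dots> \<le> l * (\<delta> + D)" using yw1 pos by (intro mult_left_mono) auto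
    finally have F21: "norm (F2 y - F1 w1) \<le> l * (\<delta> + D)" .
    then have F2: "inner (F2 y - F1 w1) (y - w2) \<le> l * (\<delta> + D) * norm (y - w2)"
      by (meson mult_right_mono norm_cauchy_schwarz norm_ge_zero order_trans)
    have "\<eta> * (norm (y - w2))\<^sup>2 \<le> inner (F2 y) (y - w2)"
      using mono[OF yK w2'(2)] w2'(3)[OF yK] by simp
    also have "\<dots> = inner (F2 y - F1 w1) (y - w2) + inner (F1 w1) (y - w2)"
      by (simp add: inner_diff_left)
    also have "\<dots> \<le> (l * (\<delta> + D) + D * e) * norm (y - w2)"
      using F1 F2 by (simp add: algebra_simps)
    finally have "(\<eta> * norm (y - w2)) * norm (y - w2) \<le> (l * (\<delta> + D) + D * e) * norm (y - w2)"
      by (simp add: power2_eq_square ac_simps)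
    moreover have "l * (\<delta> + D) \<ge> 0"
      using F21 norm_ge_zero order_trans by blast
    then have "l * (\<delta> + D) + D * e \<ge> 0" using D0 e by simp
    ultimately have "\<eta> * norm (y - w2) \<le> l * (\<delta> + D) + D * e"
      by (cases "norm (y - w2) = 0") (auto simp: mult_le_cancel_right)
    then have "norm (y - w2) \<le> (l * (\<delta> + D) + D * e) / \<eta>"
      using pos by (simp add: pos_le_divide_eq mult.commute)
    moreover have "norm (w1 - w2) \<le> norm (y - w1) + norm (y - w2)"
      by (metis norm_minus_commute norm_triangle_ineq diff_add_cancel add_diff_eq)
    ultimately show ?thesis using yw1 by linarith
  qed
  have "norm (w1 - w2) \<le> D + l * (\<delta> + D) / \<eta>"
  proof (rule field_le_epsilon)
    fix e :: real assume e: "e > 0"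
    define e' where "e' = e * \<eta> / (D + 1)"
    have "e' > 0" using e D0 pos by (simp add: e'_def)
    have "D * e' / \<eta> = e * (D / (D + 1))" using pos by (simp add: e'_def)
    also have "\<dots> \<le> e" using D0 e by (intro mult_left_le) auto
    finally have "D * e' / \<eta> \<le> e" .
    with main[OF \<open>e' > 0\<close>] show "norm (w1 - w2) \<le> D + l * (\<delta> + D) / \<eta> + e"
      by (simp add: add_divide_distrib)
  qed
  then show ?thesis by (simp add: D_def norm_minus_commute field_simps add_divide_distrib)
qed

text \<open>
  With \<open>r = l/\<eta>\<close> the smallness condition reads \<open>k\<^sup>2 (2 + 4r\<^sup>2 + 2r \<surd>(4r\<^sup>2 + 2)) < 1\<close>, and
  \<open>\<surd>(4r\<^sup>2 + 2) \<ge> 1\<close> makes the second factor at least \<open>(1 + r)\<^sup>2\<close>.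
\<close>

lemma smallness_imp_contraction:
  fixes k l \<eta> :: real
  assumes "k \<ge> 0" "l > 0" "\<eta> > 0"
    and "2 * (k\<^sup>2 / \<eta>\<^sup>2) * (l * sqrt (4 * l\<^sup>2 + 2 * \<eta>\<^sup>2) + 2 * l\<^sup>2 + \<eta>\<^sup>2) < 1"
  shows "k * (1 + l / \<eta>) < 1"
proof -
  have "\<eta> \<le> sqrt (4 * l\<^sup>2 + 2 * \<eta>\<^sup>2)" using assms by (intro real_le_rsqrt) simp
  then have "l * \<eta> \<le> l * sqrt (4 * l\<^sup>2 + 2 * \<eta>\<^sup>2)" using assms by simp
  moreover have "0 \<le> 3 * l\<^sup>2 + \<eta>\<^sup>2" by simp
  ultimately have "(\<eta> + l)\<^sup>2 \<le> 2 * (l * sqrt (4 * l\<^sup>2 + 2 * \<eta>\<^sup>2) + 2 * l\<^sup>2 + \<eta>\<^sup>2)"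
    unfolding power2_sum by argo
  then have "(k\<^sup>2 / \<eta>\<^sup>2) * (\<eta> + l)\<^sup>2
      \<le> (k\<^sup>2 / \<eta>\<^sup>2) * (2 * (l * sqrt (4 * l\<^sup>2 + 2 * \<eta>\<^sup>2) + 2 * l\<^sup>2 + \<eta>\<^sup>2))"
    by (intro mult_left_mono) auto
  also have "\<dots> < 1" using assms(4) by argo
  also have "(k\<^sup>2 / \<eta>\<^sup>2) * (\<eta> + l)\<^sup>2 = (k * (1 + l / \<eta>))\<^sup>2"
    using assms by (simp add: power2_eq_square field_simps)
  finally show ?thesis
    using power_less_imp_less_base[of "k * (1 + l / \<eta>)" 2 1] by simp
qed

section \<open>Comparison of Bochner integrals\<close>

text \<open>
  In a nonseparable space the difference of two measurable functions may fail to be measurable.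
  Subtracting a function with finitely many values is harmless.
\<close>

lemma borel_measurable_norm_diff_simple:
  fixes f :: "'s \<Rightarrow> 'a::real_normed_vector"
  assumes f: "f \<in> borel_measurable M" and S: "simple_function M S"
  shows "(\<lambda>x. norm (f x - S x)) \<in> borel_measurable M"
proof -
  have "(\<lambda>x. norm (f x - c)) \<in> borel_measurable M" for c
    by (rule borel_measurable_continuous_on[OF _ f]) (intro continuous_intros)
  moreover have "countable (S ` space M)"
    using S by (auto simp: simple_function_def countable_finite)
  moreover have "S \<in> measurable M (count_space (S ` space M))"
    using S by (auto simp: measurable_count_space_eq2 simple_function_def)
  ultimately show ?thesis
    using measurable_compose_countable'[where f = "\<lambda>c x. norm (f x - c)" and N = borel
        and g = S and I = "S ` space M"] by simp
qed

text \<open>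
  The integrals themselves need not be subtracted inside the integral sign: the approximating simple
  functions \<open>S\<^sub>1\<close>, \<open>S\<^sub>2\<close> can, and \<open>\<parallel>S\<^sub>1 - S\<^sub>2\<parallel>\<close> is at most \<open>B\<close> plus the two approximation errors.
\<close>

lemma bochner_integral_normed_diff_le:
  fixes f1 f2 :: "'s \<Rightarrow> 'a::real_normed_vector" and B :: "'s \<Rightarrow> real"
  assumes "has_bochner_integral_normed M f1 J1" "has_bochner_integral_normed M f2 J2"
    and B[measurable]: "B \<in> borel_measurable M" and le: "\<And>x. norm (f1 x - f2 x) \<le> B x"
  shows "ennreal (norm (J1 - J2)) \<le> (\<integral>\<^sup>+x. ennreal (B x) \<partial>M)"
proof -
  obtain S1 S2 where f: "f1 \<in> borel_measurable M" "f2 \<in> borel_measurable M"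
    and S: "\<And>i. Bochner_Integration.simple_bochner_integrable M (S1 i)"
           "\<And>i. Bochner_Integration.simple_bochner_integrable M (S2 i)"
    and e: "(\<lambda>i. \<integral>\<^sup>+ y. ennreal (norm (f1 y - S1 i y)) \<partial>M) \<longlonglongrightarrow> 0"
           "(\<lambda>i. \<integral>\<^sup>+ y. ennreal (norm (f2 y - S2 i y)) \<partial>M) \<longlonglongrightarrow> 0"
    and J: "(\<lambda>i. Bochner_Integration.simple_bochner_integral M (S1 i)) \<longlonglongrightarrow> J1"
           "(\<lambda>i. Bochner_Integration.simple_bochner_integral M (S2 i)) \<longlonglongrightarrow> J2"
    using assms(1,2) unfolding has_bochner_integral_normed_def by blast
  have sf: "simple_function M (S1 i)" "simple_function M (S2 i)" for i
    using S[of i] by (auto elim: Bochner_Integration.simple_bochner_integrable.cases)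
  note [measurable] = borel_measurable_norm_diff_simple[OF f(1) sf(1)]
    borel_measurable_norm_diff_simple[OF f(2) sf(2)]
  have bound: "ennreal (norm (Bochner_Integration.simple_bochner_integral M (S1 i)
        - Bochner_Integration.simple_bochner_integral M (S2 i)))
      \<le> (\<integral>\<^sup>+x. ennreal (B x) \<partial>M) + (\<integral>\<^sup>+ y. ennreal (norm (f1 y - S1 i y)) \<partial>M)
        + (\<integral>\<^sup>+ y. ennreal (norm (f2 y - S2 i y)) \<partial>M)" (is "?l \<le> _") for i
  proof -
    have d: "Bochner_Integration.simple_bochner_integrable M (\<lambda>x. S1 i x - S2 i x)"
      using S by (intro Bochner_Integration.simple_bochner_integrable_compose2[where p = "(-)"]) auto
    have "?l = ennreal (norm (Bochner_Integration.simple_bochner_integral M (\<lambda>x. S1 i x - S2 i x)))"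
      by (simp add: Bochner_Integration.simple_bochner_integral_diff[OF S(1) S(2)])
    also have "\<dots> \<le> ennreal (Bochner_Integration.simple_bochner_integral M
        (\<lambda>x. norm (S1 i x - S2 i x)))"
      by (intro ennreal_leI Bochner_Integration.simple_bochner_integral_norm_bound d)
    also have "\<dots> = (\<integral>\<^sup>+x. ennreal (norm (S1 i x - S2 i x)) \<partial>M)"
      using d by (intro Bochner_Integration.simple_bochner_integral_eq_nn_integral
          Bochner_Integration.simple_bochner_integrable_compose2[where p = "\<lambda>x y. norm (x - y)"] S)
        auto
    also have "\<dots> \<le> (\<integral>\<^sup>+x. ennreal (B x) + ennreal (norm (f1 x - S1 i x))
        + ennreal (norm (f2 x - S2 i x)) \<partial>M)"
    proof (rule nn_integral_mono)
      fix x
      have "S1 i x - S2 i x = ((f1 x - f2 x) - (f1 x - S1 i x)) + (f2 x - S2 i x)" by simp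
      then have "norm (S1 i x - S2 i x)
          \<le> norm (f1 x - f2 x) + norm (f1 x - S1 i x) + norm (f2 x - S2 i x)"
        using norm_triangle_ineq[of "(f1 x - f2 x) - (f1 x - S1 i x)" "f2 x - S2 i x"]
          norm_triangle_ineq4[of "f1 x - f2 x" "f1 x - S1 i x"] by simp
      also have "\<dots> \<le> B x + norm (f1 x - S1 i x) + norm (f2 x - S2 i x)" using le by simp
      finally have *: "norm (S1 i x - S2 i x) \<le> B x + norm (f1 x - S1 i x) + norm (f2 x - S2 i x)" .
      have "B x \<ge> 0" using le[of x] norm_ge_zero order_trans by blast
      with * show "ennreal (norm (S1 i x - S2 i x))
          \<le> ennreal (B x) + ennreal (norm (f1 x - S1 i x)) + ennreal (norm (f2 x - S2 i x))"
        by (simp add: ennreal_leI flip: ennreal_plus)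
    qed
    also have "\<dots> = (\<integral>\<^sup>+x. ennreal (B x) \<partial>M) + (\<integral>\<^sup>+ y. ennreal (norm (f1 y - S1 i y)) \<partial>M)
        + (\<integral>\<^sup>+ y. ennreal (norm (f2 y - S2 i y)) \<partial>M)"
      by (simp add: nn_integral_add)
    finally show ?thesis .
  qed
  have "(\<lambda>i. (\<integral>\<^sup>+x. ennreal (B x) \<partial>M) + (\<integral>\<^sup>+ y. ennreal (norm (f1 y - S1 i y)) \<partial>M)
        + (\<integral>\<^sup>+ y. ennreal (norm (f2 y - S2 i y)) \<partial>M)) \<longlonglongrightarrow> (\<integral>\<^sup>+x. ennreal (B x) \<partial>M) + 0 + 0"
    by (intro tendsto_add tendsto_const e)
  moreover have "(\<lambda>i. ennreal (norm (Bochner_Integration.simple_bochner_integral M (S1 i)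
        - Bochner_Integration.simple_bochner_integral M (S2 i)))) \<longlonglongrightarrow> ennreal (norm (J1 - J2))"
    by (intro tendsto_ennrealI tendsto_norm tendsto_diff J)
  ultimately show ?thesis
    using bound by (auto intro: LIMSEQ_le)
qed

lemma has_bochner_integral_normed_zero:
  "has_bochner_integral_normed M (\<lambda>x. 0 :: 'a::real_normed_vector) 0"
  unfolding has_bochner_integral_normed_def
proof (intro conjI exI[of _ "\<lambda>i x. 0"] allI)
  show "Bochner_Integration.simple_bochner_integrable M (\<lambda>x. 0 :: 'a)"
    by (auto intro!: Bochner_Integration.simple_bochner_integrable.intros)
  have "Bochner_Integration.simple_bochner_integral M (\<lambda>x. 0 :: 'a) = 0"
    by (auto simp: Bochner_Integration.simple_bochner_integral_def intro!: sum.neutral)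
  then show "(\<lambda>i. Bochner_Integration.simple_bochner_integral M (\<lambda>x. 0 :: 'a)) \<longlonglongrightarrow> 0" by simp
qed auto

section \<open>A fractional Gronwall inequality\<close>

text \<open>
  Extending the range of integration from \<open>[0, s]\<close> to \<open>(-\<infinity>, s]\<close> and substituting \<open>\<zeta> = s - r/\<mu>\<close>
  turns the integral into Euler's integral for \<open>\<Gamma>(q)\<close>.
\<close>

lemma nn_integral_singular_kernel_exp_le:
  fixes q \<mu> s :: real
  assumes q: "q > 0" and l: "\<mu> > 0"
  shows "(\<integral>\<^sup>+\<zeta>. ennreal (indicator {0..s} \<zeta> * ((s - \<zeta>) powr (q - 1) * exp (\<mu> * \<zeta>))) \<partial>lborel)
    \<le> ennreal (exp (\<mu> * s) * \<mu> powr (- q) * Gamma q)"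
proof -
  let ?g = "\<lambda>t. indicator {0..} t * t powr (q - 1) / exp t :: real"
  have "(\<integral>\<^sup>+\<zeta>. ennreal (indicator {0..s} \<zeta> * ((s - \<zeta>) powr (q - 1) * exp (\<mu> * \<zeta>))) \<partial>lborel)
    = ennreal \<bar>- (1 / \<mu>)\<bar> * (\<integral>\<^sup>+r. ennreal (indicator {0..s} (s + - (1 / \<mu>) * r)
        * ((s - (s + - (1 / \<mu>) * r)) powr (q - 1) * exp (\<mu> * (s + - (1 / \<mu>) * r)))) \<partial>lborel)"
    using l by (intro nn_integral_real_affine) auto
  also have "\<dots> \<le> ennreal (1 / \<mu>) *
      (\<integral>\<^sup>+r. ennreal (exp (\<mu> * s) * \<mu> powr (1 - q)) * ennreal (?g r) \<partial>lborel)"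
  proof (rule mult_mono)
    show "(\<integral>\<^sup>+r. ennreal (indicator {0..s} (s + - (1 / \<mu>) * r)
        * ((s - (s + - (1 / \<mu>) * r)) powr (q - 1) * exp (\<mu> * (s + - (1 / \<mu>) * r)))) \<partial>lborel)
      \<le> (\<integral>\<^sup>+r. ennreal (exp (\<mu> * s) * \<mu> powr (1 - q)) * ennreal (?g r) \<partial>lborel)"
    proof (rule nn_integral_mono)
      fix r :: real
      show "ennreal (indicator {0..s} (s + - (1 / \<mu>) * r)
          * ((s - (s + - (1 / \<mu>) * r)) powr (q - 1) * exp (\<mu> * (s + - (1 / \<mu>) * r))))
        \<le> ennreal (exp (\<mu> * s) * \<mu> powr (1 - q)) * ennreal (?g r)"
      proof (cases "r \<ge> 0")
        case True
        have "(r / \<mu>) powr (q - 1) = r powr (q - 1) * \<mu> powr (1 - q)"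
          using True l by (simp add: powr_divide powr_diff)
        moreover have "exp (\<mu> * (s - r / \<mu>)) = exp (\<mu> * s) / exp r"
          using l by (simp add: algebra_simps exp_diff)
        ultimately have "indicator {0..s} (s + - (1 / \<mu>) * r)
          * ((s - (s + - (1 / \<mu>) * r)) powr (q - 1) * exp (\<mu> * (s + - (1 / \<mu>) * r)))
          \<le> exp (\<mu> * s) * \<mu> powr (1 - q) * ?g r"
          using True by (simp add: indicator_def mult_ac)
        then show ?thesis by (simp add: ennreal_leI flip: ennreal_mult')
      next
        case False
        then have "s + - (1 / \<mu>) * r > s" using l by (simp add: divide_neg_pos)
        then show ?thesis by simp
      qed
    qed
  qed (use l in auto)
  also have "\<dots> = ennreal (1 / \<mu>) * (ennreal (exp (\<mu> * s) * \<mu> powr (1 - q)) * ennreal (Gamma q))"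
    by (subst nn_integral_cmult) (use Gamma_conv_nn_integral_real[OF q] in auto)
  also have "\<dots> = ennreal ((1 / \<mu>) * (exp (\<mu> * s) * \<mu> powr (1 - q) * Gamma q))"
    using l q by (simp add: Gamma_real_pos less_imp_le flip: ennreal_mult')
  also have "(1 / \<mu>) * (exp (\<mu> * s) * \<mu> powr (1 - q) * Gamma q)
      = exp (\<mu> * s) * \<mu> powr (- q) * Gamma q"
    using l by (simp add: powr_diff powr_minus field_simps)
  finally show ?thesis .
qed

text \<open>
  Applied to the integral equation, this turns a pointwise exponential bound on the right-hand sides
  into one for the solutions with the same rate, gaining the factor \<open>\<mu>\<^bsup>-q\<^esup>\<close>.
\<close>

lemma rl_integral_diff_le:
  fixes F1 F2 :: "real \<Rightarrow> 'a::real_normed_vector"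
  assumes q: "q > 0" and l: "\<mu> > 0" and C: "C \<ge> 0"
    and v: "has_rl_integral q F1 s v1" "has_rl_integral q F2 s v2"
    and le: "\<And>\<zeta>. \<zeta> \<in> {0..s} \<Longrightarrow> norm (F1 \<zeta> - F2 \<zeta>) \<le> C * exp (\<mu> * \<zeta>)"
  shows "norm (v1 - v2) \<le> C * exp (\<mu> * s) * \<mu> powr (- q)"
proof -
  obtain J1 J2 where J: "has_bochner_integral_normed lborel
        (\<lambda>\<zeta>. indicator {0..s} \<zeta> *\<^sub>R ((s - \<zeta>) powr (q - 1) *\<^sub>R F1 \<zeta>)) J1"
      "has_bochner_integral_normed lborel
        (\<lambda>\<zeta>. indicator {0..s} \<zeta> *\<^sub>R ((s - \<zeta>) powr (q - 1) *\<^sub>R F2 \<zeta>)) J2"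
    and v12: "v1 = (1 / Gamma q) *\<^sub>R J1" "v2 = (1 / Gamma q) *\<^sub>R J2"
    using v unfolding has_rl_integral_def by blast
  let ?B = "\<lambda>\<zeta>. C * (indicator {0..s} \<zeta> * ((s - \<zeta>) powr (q - 1) * exp (\<mu> * \<zeta>))) :: real"
  have "ennreal (norm (J1 - J2)) \<le> (\<integral>\<^sup>+\<zeta>. ennreal (?B \<zeta>) \<partial>lborel)"
  proof (rule bochner_integral_normed_diff_le[OF J])
    fix \<zeta> :: real
    show "norm (indicator {0..s} \<zeta> *\<^sub>R ((s - \<zeta>) powr (q - 1) *\<^sub>R F1 \<zeta>)
        - indicator {0..s} \<zeta> *\<^sub>R ((s - \<zeta>) powr (q - 1) *\<^sub>R F2 \<zeta>)) \<le> ?B \<zeta>"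
    proof (cases "\<zeta> \<in> {0..s}")
      case True
      then have "norm ((s - \<zeta>) powr (q - 1) *\<^sub>R (F1 \<zeta> - F2 \<zeta>))
          \<le> (s - \<zeta>) powr (q - 1) * (C * exp (\<mu> * \<zeta>))"
        using le[OF True] by (simp add: mult_left_mono)
      then show ?thesis using True by (simp add: ac_simps scaleR_diff_right)
    qed simp
  qed auto
  also have "\<dots> = ennreal C *
      (\<integral>\<^sup>+\<zeta>. ennreal (indicator {0..s} \<zeta> * ((s - \<zeta>) powr (q - 1) * exp (\<mu> * \<zeta>))) \<partial>lborel)"
    using C by (simp add: ennreal_mult' nn_integral_cmult)
  also have "\<dots> \<le> ennreal C * ennreal (exp (\<mu> * s) * \<mu> powr (- q) * Gamma q)"
    by (intro mult_left_mono nn_integral_singular_kernel_exp_le q l) auto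
  also have "\<dots> = ennreal (C * (exp (\<mu> * s) * \<mu> powr (- q) * Gamma q))"
    using C by (simp add: ennreal_mult')
  finally have "norm (J1 - J2) \<le> C * (exp (\<mu> * s) * \<mu> powr (- q) * Gamma q)"
    using C q by (subst (asm) ennreal_le_iff) (auto simp: Gamma_real_pos less_imp_le)
  moreover have "norm (v1 - v2) = norm (J1 - J2) / Gamma q"
    using Gamma_real_pos[OF q] by (simp add: v12 flip: scaleR_diff_right)
  ultimately show ?thesis using Gamma_real_pos[OF q] by (simp add: pos_divide_le_eq ac_simps)
qed

text \<open>This recovers the initial condition \<open>x(0) = x\<^sub>0 + \<psi>(x)\<close> from the integral equation.\<close>

lemma rl_integral_at_0:
  fixes F :: "real \<Rightarrow> 'a::real_normed_vector"
  assumes "has_rl_integral q F 0 v"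
  shows "v = 0"
proof -
  obtain J where J: "has_bochner_integral_normed lborel
        (\<lambda>\<zeta>. indicator {0..0} \<zeta> *\<^sub>R ((0 - \<zeta>) powr (q - 1) *\<^sub>R F \<zeta>)) J"
    and v: "v = (1 / Gamma q) *\<^sub>R J"
    using assms unfolding has_rl_integral_def by blast
  have "ennreal (norm (J - 0)) \<le> (\<integral>\<^sup>+\<zeta>. ennreal 0 \<partial>(lborel :: real measure))"
    by (rule bochner_integral_normed_diff_le[OF J has_bochner_integral_normed_zero])
       (auto simp: indicator_def)
  then show ?thesis by (simp add: v)
qed

text \<open>
  The weight \<open>e\<^bsup>-\<mu>s\<^esup>\<close> with \<open>\<mu>\<^bsup>q\<^esup> = 2M\<close> makes the linear part of the estimate a contraction with factor
  \<open>1/2\<close>, so the weighted maximum absorbs itself.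
\<close>

lemma rl_integral_gronwall:
  fixes F1 F2 d :: "real \<Rightarrow> 'a::real_normed_vector"
  assumes q: "q > 0" and T: "T \<ge> 0" and M: "M > 0" and eps: "\<epsilon> \<ge> 0"
    and cont: "continuous_on {0..T} d"
    and d: "\<And>s. s \<in> {0..T} \<Longrightarrow>
      \<exists>v1 v2. has_rl_integral q F1 s v1 \<and> has_rl_integral q F2 s v2 \<and> d s = v1 - v2"
    and F: "\<And>s. s \<in> {0..T} \<Longrightarrow> norm (F1 s - F2 s) \<le> M * norm (d s) + \<epsilon>"
    and s: "s \<in> {0..T}"
  shows "norm (d s) \<le> \<epsilon> / M * exp ((2 * M) powr (1 / q) * T)"
proof -
  define \<mu> where "\<mu> = (2 * M) powr (1 / q)"
  have l: "\<mu> > 0" using M by (simp add: \<mu>_def)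
  have "\<mu> powr q = 2 * M" using M q by (simp add: \<mu>_def powr_powr)
  then have lq: "\<mu> powr (- q) = 1 / (2 * M)" by (simp only: powr_minus inverse_eq_divide)
  have "continuous_on {0..T} (\<lambda>s. exp (- \<mu> * s) * norm (d s))"
    by (intro continuous_intros cont)
  then obtain m where m: "m \<in> {0..T}"
    and max: "\<And>s. s \<in> {0..T} \<Longrightarrow> exp (- \<mu> * s) * norm (d s) \<le> exp (- \<mu> * m) * norm (d m)"
    using continuous_attains_sup[of "{0..T}" "\<lambda>s. exp (- \<mu> * s) * norm (d s)"] T by auto
  \<comment> \<open>\<open>N\<close> is the Bielecki norm of \<open>d\<close>; it suffices to estimate \<open>d\<close> where it is attained\<close>
  define N where "N = exp (- \<mu> * m) * norm (d m)"
  have N0: "N \<ge> 0" by (simp add: N_def)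
  have dN: "norm (d s) \<le> N * exp (\<mu> * s)" if "s \<in> {0..T}" for s
    using max[OF that] by (simp add: N_def exp_minus field_simps)
  obtain v1 v2 where v: "has_rl_integral q F1 m v1" "has_rl_integral q F2 m v2" "d m = v1 - v2"
    using d[OF m] by blast
  have "norm (d m) \<le> (M * N + \<epsilon>) * exp (\<mu> * m) * \<mu> powr (- q)"
    unfolding v(3)
  proof (rule rl_integral_diff_le[OF q l _ v(1,2)])
    fix \<zeta> assume z: "\<zeta> \<in> {0..m}"
    then have zT: "\<zeta> \<in> {0..T}" using m by auto
    have "norm (F1 \<zeta> - F2 \<zeta>) \<le> M * norm (d \<zeta>) + \<epsilon>" by (rule F[OF zT])
    also have "\<dots> \<le> M * (N * exp (\<mu> * \<zeta>)) + \<epsilon> * exp (\<mu> * \<zeta>)"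
      using dN[OF zT] M eps l z by (intro add_mono mult_left_mono mult_le_cancel_left1[THEN iffD2]) auto
    finally show "norm (F1 \<zeta> - F2 \<zeta>) \<le> (M * N + \<epsilon>) * exp (\<mu> * \<zeta>)" by (simp add: algebra_simps)
  qed (use M N0 eps in auto)
  then have "N \<le> (M * N + \<epsilon>) / (2 * M)"
    by (simp add: N_def lq exp_minus field_simps)
  then have "N \<le> \<epsilon> / M" using M by (simp add: field_simps)
  have "norm (d s) \<le> N * exp (\<mu> * s)" by (rule dN[OF s])
  also have "\<dots> \<le> \<epsilon> / M * exp (\<mu> * T)"
    using \<open>N \<le> \<epsilon> / M\<close> N0 s l by (intro mult_mono) auto
  finally show ?thesis by (simp add: \<mu>_def)
qed

section \<open>The Mittag-Leffler function is at least one\<close>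

text \<open>Restrict Euler's integral to \<open>[A, \<infinity>)\<close>, where \<open>t\<^bsup>x\<^esup> \<ge> A\<^bsup>x\<^esup>\<close>.\<close>

lemma Gamma_plus1_ge_powr:
  fixes A x :: real
  assumes "A \<ge> 0" "x \<ge> 0"
  shows "A powr x * exp (- A) \<le> Gamma (x + 1)"
proof -
  have "((\<lambda>t. A powr x * exp (- 1 * t)) has_integral A powr x * (exp (- 1 * A) / 1)) {A..}"
    by (intro has_integral_mult_right has_integral_exp_minus_to_infinity) simp
  then have "((\<lambda>t. if t \<in> {A..} then A powr x * exp (- 1 * t) else 0)
      has_integral A powr x * exp (- A)) {0..}"
    using assms by (subst has_integral_restrict) auto
  moreover have "((\<lambda>t. t powr (x + 1 - 1) / exp t) has_integral Gamma (x + 1)) {0..}"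
    using assms by (intro Gamma_integral_real) auto
  ultimately show ?thesis
  proof (rule has_integral_le)
    fix t :: real assume "t \<in> {0..}"
    then show "(if t \<in> {A..} then A powr x * exp (- 1 * t) else 0) \<le> t powr (x + 1 - 1) / exp t"
      using assms by (auto simp: exp_minus field_simps intro!: powr_mono2)
  qed
qed

text \<open>
  Bounding the value of the series from below requires its convergence.  With \<open>A\<^bsup>q\<^esup> = 2(t + 1)\<close> the
  bound on \<open>\<Gamma>\<close> dominates the series by a geometric one; its term of index \<open>0\<close> is \<open>1\<close>.
\<close>

lemma mittag_leffler_ge_1:
  assumes q: "q > 0" and t: "t \<ge> 0"
  shows "mittag_leffler q t \<ge> 1"
proof -
  define A where "A = (2 * (t + 1)) powr (1 / q)"
  have G: "(2 * (t + 1)) ^ n * exp (- A) \<le> Gamma (real n * q + 1)" for n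
  proof -
    have "A powr (real n * q) = (2 * (t + 1)) powr real n"
      using q t by (simp add: A_def powr_powr)
    also have "\<dots> = (2 * (t + 1)) ^ n" using t by (simp add: powr_realpow)
    finally show ?thesis using Gamma_plus1_ge_powr[of A "real n * q"] q by (simp add: A_def)
  qed
  have Gpos: "Gamma (real n * q + 1) > 0" for n
    using q by (intro Gamma_real_pos) (simp add: add_nonneg_pos)
  have bd: "t ^ n / Gamma (real n * q + 1) \<le> exp A * (1 / 2) ^ n" for n
  proof -
    have "t ^ n * 2 ^ n = (2 * t) ^ n" by (simp add: power_mult_distrib)
    also have "\<dots> \<le> (2 * (t + 1)) ^ n" using t by (intro power_mono) auto
    also have "\<dots> \<le> exp A * Gamma (real n * q + 1)"
      using G[of n] by (simp add: exp_minus field_simps)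
    finally show ?thesis using Gpos[of n] by (simp add: field_simps power_one_over)
  qed
  have sm: "summable (\<lambda>n. t ^ n / Gamma (real n * q + 1))"
  proof (rule summable_comparison_test')
    show "summable (\<lambda>n. exp A * (1 / 2) ^ n)" by (intro summable_mult summable_geometric) simp
    show "norm (t ^ n / Gamma (real n * q + 1)) \<le> exp A * (1 / 2) ^ n" if "n \<ge> 0" for n
      using bd[of n] Gpos[of n] t by simp
  qed
  have "(\<Sum>n<1. t ^ n / Gamma (real n * q + 1)) \<le> (\<Sum>n. t ^ n / Gamma (real n * q + 1))"
    using sm t Gpos by (intro sum_le_suminf) (auto simp: less_imp_le)
  then show ?thesis by (simp add: mittag_leffler_def)
qed

section \<open>Stability\<close>

theorem theorem4p1:
  fixes T q \<gamma> l\<^sub>G \<eta>\<^sub>G l\<^sub>K l\<^sub>g l\<^sub>f l\<^sub>\<psi> :: real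
    and \<Omega> :: "'b::{real_inner, banach} set"
    and K :: "'b \<Rightarrow> 'b set"
    and f :: "real \<Rightarrow> 'a::{real_inner, banach} \<Rightarrow> 'a"
    and g :: "real \<Rightarrow> 'a \<Rightarrow> 'b \<Rightarrow> 'a"
    and G :: "real \<Rightarrow> 'a \<Rightarrow> 'b \<Rightarrow> 'b"
    and \<psi> :: "(real \<Rightarrow> 'a) \<Rightarrow> 'a"
    and x0 :: 'a
  assumes T: "T > 0" and q: "0 < q" "q \<le> 1" and \<gamma>: "\<gamma> > 0"
    and \<Omega>: "\<Omega> \<noteq> {}" "closed \<Omega>" "convex \<Omega>"
    and K: "\<And>u. u \<in> \<Omega> \<Longrightarrow> K u \<subseteq> \<Omega> \<and> K u \<noteq> {} \<and> closed (K u) \<and> convex (K u)"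
    and G_pos: "l\<^sub>G > 0" "\<eta>\<^sub>G > 0"
    and G_lipschitz:
      "\<And>s1 s2 x1 x2 u1 u2. \<lbrakk>s1 \<in> {0..T}; s2 \<in> {0..T}; u1 \<in> \<Omega>; u2 \<in> \<Omega>\<rbrakk> \<Longrightarrow>
         norm (G s2 x2 u2 - G s1 x1 u1) \<le> l\<^sub>G * (\<bar>s2 - s1\<bar> + norm (x2 - x1) + norm (u2 - u1))"
    and G_pseudomonotone:
      "\<And>s x u u1 u2. \<lbrakk>s \<in> {0..T}; u \<in> \<Omega>; u1 \<in> K u; u2 \<in> K u; inner (G s x u2) (u1 - u2) \<ge> 0\<rbrakk> \<Longrightarrow>
         inner (G s x u1) (u1 - u2) \<ge> \<eta>\<^sub>G * (norm (u1 - u2))\<^sup>2"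
    and K_lipschitz: "l\<^sub>K \<ge> 0"
      "\<And>u1 u2 \<omega>. \<lbrakk>u1 \<in> \<Omega>; u2 \<in> \<Omega>\<rbrakk> \<Longrightarrow>
         norm (metric_projection (K u2) \<omega> - metric_projection (K u1) \<omega>) \<le> l\<^sub>K * norm (u2 - u1)"
    and g_continuous: "continuous_on ({0..T} \<times> UNIV \<times> UNIV) (\<lambda>(s, x, u). g s x u)"
    and g_lipschitz: "l\<^sub>g > 0"
      "\<And>s x1 x2 u1 u2. s \<in> {0..T} \<Longrightarrow>
         norm (g s x2 u2 - g s x1 u1) \<le> l\<^sub>g * (norm (x2 - x1) + norm (u2 - u1))"
    and f_continuous: "continuous_on ({0..T} \<times> UNIV) (\<lambda>(s, x). f s x)"
    and f_lipschitz: "l\<^sub>f > 0"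
      "\<And>s x1 x2. s \<in> {0..T} \<Longrightarrow> norm (f s x2 - f s x1) \<le> l\<^sub>f * norm (x2 - x1)"
    and \<psi>_continuous:
      "\<forall>y \<in> cont_maps {0..T} UNIV. \<forall>e>0. \<exists>d>0. \<forall>y' \<in> cont_maps {0..T} UNIV.
         bielecki_norm \<gamma> T (\<lambda>s. y' s - y s) < d \<longrightarrow> norm (\<psi> y' - \<psi> y) < e"
    and \<psi>_lipschitz: "0 < l\<^sub>\<psi>" "l\<^sub>\<psi> < 1"
      "\<And>y1 y2. \<lbrakk>y1 \<in> cont_maps {0..T} UNIV; y2 \<in> cont_maps {0..T} UNIV\<rbrakk> \<Longrightarrow>
         norm (\<psi> y2 - \<psi> y1) \<le> l\<^sub>\<psi> * bielecki_norm \<gamma> T (\<lambda>s. y2 s - y1 s)"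
    and contraction:
      "2 * (l\<^sub>K\<^sup>2 / \<eta>\<^sub>G\<^sup>2) * (l\<^sub>G * sqrt (4 * l\<^sub>G\<^sup>2 + 2 * \<eta>\<^sub>G\<^sup>2) + 2 * l\<^sub>G\<^sup>2 + \<eta>\<^sub>G\<^sup>2) < 1"
  shows "mlhu_stable T q \<Omega> K f g G \<psi> x0"
proof -
  define \<kappa> where "\<kappa> = 1 - l\<^sub>K * (1 + l\<^sub>G / \<eta>\<^sub>G)"
  have \<kappa>: "\<kappa> > 0"
    using smallness_imp_contraction[OF K_lipschitz(1) G_pos contraction] by (simp add: \<kappa>_def)
  define L where "L = l\<^sub>G / \<eta>\<^sub>G / \<kappa>"
  have L: "L > 0" using \<kappa> G_pos by (simp add: L_def)
  define M where "M = l\<^sub>f + l\<^sub>g * (1 + L)"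
  have M: "M > 0" using f_lipschitz(1) g_lipschitz(1) L by (simp add: M_def add_pos_pos)
  define c where "c = exp ((2 * M) powr (1 / q) * T) / M"
  have c: "c > 0" using M by (simp add: c_def)
  have u_lipschitz: "norm (w2 - w1) \<le> L * norm (x2 - x1)"
    if s: "s \<in> {0..T}" and w: "w1 \<in> SOL \<Omega> K (G s x1)" "w2 \<in> SOL \<Omega> K (G s x2)" for s x1 x2 w1 w2
  proof -
    have w\<Omega>: "w1 \<in> \<Omega>" "w2 \<in> \<Omega>" using w by (auto simp: SOL_def)
    have "\<kappa> * norm (w1 - w2) \<le> l\<^sub>G / \<eta>\<^sub>G * norm (x2 - x1)"
      unfolding \<kappa>_def
    proof (rule SOL_lipschitz[OF K w _ _ G_pos(2)])
      show "norm (G s x2 v - G s x1 w1) \<le> l\<^sub>G * (norm (x2 - x1) + norm (v - w1))" if "v \<in> \<Omega>" for v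
        using G_lipschitz[OF s s w\<Omega>(1) that, of x2 x1] by simp
      show "\<eta>\<^sub>G * (norm (u1 - u2))\<^sup>2 \<le> inner (G s x2 u1) (u1 - u2)"
        if "u1 \<in> K w2" "u2 \<in> K w2" "0 \<le> inner (G s x2 u2) (u1 - u2)" for u1 u2
        by (rule G_pseudomonotone[OF s w\<Omega>(2) that])
      show "norm (metric_projection (K w2) \<omega> - metric_projection (K w1) \<omega>) \<le> l\<^sub>K * norm (w2 - w1)"
        for \<omega> by (rule K_lipschitz(2)[OF w\<Omega>])
    qed (use G_pos in auto)
    then show ?thesis
      using \<kappa> G_pos by (simp add: L_def field_simps norm_minus_commute)
  qed
  have stable: "norm (z s - x s) \<le> c * \<epsilon> * mittag_leffler q s"
    if eps: "\<epsilon> > 0" and sol: "nfdqvi_solution T q \<Omega> K f g G \<psi> x0 x u"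
      and ineq: "nfdqvi_ineq_solution T q \<Omega> K f g G \<epsilon> x z \<upsilon>" and s: "s \<in> {0..T}"
    for \<epsilon> x u z \<upsilon> s
  proof -
    have z: "continuous_on {0..T} z" "z 0 = x 0"
      and \<upsilon>: "\<forall>s\<in>{0..T}. \<upsilon> s \<in> SOL \<Omega> K (G s (z s))"
      and "\<exists>h\<in>{h. continuous_on {0..T} h \<and> h ` {0..T} \<subseteq> UNIV}. (\<forall>s\<in>{0..T}. norm (h s) \<le> \<epsilon>) \<and>
        (\<forall>s\<in>{0..T}. \<exists>v. has_rl_integral q
           (\<lambda>\<zeta>. f \<zeta> (z \<zeta>) + g \<zeta> (z \<zeta>) (\<upsilon> \<zeta>) + h \<zeta>) s v \<and> z s = z 0 + v)"
      using ineq unfolding nfdqvi_ineq_solution_def cont_maps_def mem_Collect_eq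
      by - (elim conjE, assumption)+
    then obtain h where h: "\<forall>s\<in>{0..T}. norm (h s) \<le> \<epsilon>"
      and zv: "\<forall>s\<in>{0..T}. \<exists>v. has_rl_integral q
           (\<lambda>\<zeta>. f \<zeta> (z \<zeta>) + g \<zeta> (z \<zeta>) (\<upsilon> \<zeta>) + h \<zeta>) s v \<and> z s = z 0 + v"
      by (elim bexE conjE)
    have x: "continuous_on {0..T} x"
      and xu: "\<forall>s\<in>{0..T}. (\<exists>v. has_rl_integral q
           (\<lambda>\<zeta>. f \<zeta> (x \<zeta>) + g \<zeta> (x \<zeta>) (u \<zeta>)) s v \<and> x s = x0 + \<psi> x + v) \<and>
           u s \<in> SOL \<Omega> K (G s (x s))"
      using sol unfolding nfdqvi_solution_def cont_maps_def mem_Collect_eq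
      by - (elim conjE, assumption)+
    note h = bspec[OF h] and zv = bspec[OF zv] and \<upsilon> = bspec[OF \<upsilon>]
      and xv = conjunct1[OF bspec[OF xu]] and u = conjunct2[OF bspec[OF xu]]
    have x_init: "x 0 = x0 + \<psi> x" using xv[of 0] T by (auto dest: rl_integral_at_0)
    have "norm (z s - x s) \<le> \<epsilon> / M * exp ((2 * M) powr (1 / q) * T)"
    proof (rule rl_integral_gronwall[where d = "\<lambda>s. z s - x s"])
      show "continuous_on {0..T} (\<lambda>s. z s - x s)" by (intro continuous_intros z x)
      show "\<exists>v1 v2. has_rl_integral q (\<lambda>\<zeta>. f \<zeta> (z \<zeta>) + g \<zeta> (z \<zeta>) (\<upsilon> \<zeta>) + h \<zeta>) s v1 \<and>
          has_rl_integral q (\<lambda>\<zeta>. f \<zeta> (x \<zeta>) + g \<zeta> (x \<zeta>) (u \<zeta>)) s v2 \<and> z s - x s = v1 - v2"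
        if s: "s \<in> {0..T}" for s
      proof -
        obtain v1 v2 where "has_rl_integral q (\<lambda>\<zeta>. f \<zeta> (z \<zeta>) + g \<zeta> (z \<zeta>) (\<upsilon> \<zeta>) + h \<zeta>) s v1"
          "z s = z 0 + v1" "has_rl_integral q (\<lambda>\<zeta>. f \<zeta> (x \<zeta>) + g \<zeta> (x \<zeta>) (u \<zeta>)) s v2"
          "x s = x0 + \<psi> x + v2"
          using zv[OF s] xv[OF s] by blast
        then show ?thesis using x_init z(2) by (intro exI[of _ v1] exI[of _ v2]) simp
      qed
      show "norm (f s (z s) + g s (z s) (\<upsilon> s) + h s - (f s (x s) + g s (x s) (u s)))
          \<le> M * norm (z s - x s) + \<epsilon>" if "s \<in> {0..T}" for s
      proof -
        have "norm (f s (z s) + g s (z s) (\<upsilon> s) + h s - (f s (x s) + g s (x s) (u s)))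
          = norm ((f s (z s) - f s (x s)) + (g s (z s) (\<upsilon> s) - g s (x s) (u s)) + h s)"
          by (simp add: algebra_simps)
        also have "\<dots> \<le> norm (f s (z s) - f s (x s)) + norm (g s (z s) (\<upsilon> s) - g s (x s) (u s))
            + norm (h s)"
          by (meson add_right_mono norm_triangle_ineq order_trans)
        also have "\<dots> \<le> l\<^sub>f * norm (z s - x s) + l\<^sub>g * (norm (z s - x s) + L * norm (z s - x s)) + \<epsilon>"
        proof (intro add_mono f_lipschitz(2) h that)
          have "norm (g s (z s) (\<upsilon> s) - g s (x s) (u s))
              \<le> l\<^sub>g * (norm (z s - x s) + norm (\<upsilon> s - u s))"
            by (rule g_lipschitz(2)[OF that])
          also have "\<dots> \<le> l\<^sub>g * (norm (z s - x s) + L * norm (z s - x s))"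
            using u_lipschitz[OF that u[OF that] \<upsilon>[OF that]] g_lipschitz(1)
            by (intro mult_left_mono add_left_mono) auto
          finally show "norm (g s (z s) (\<upsilon> s) - g s (x s) (u s))
              \<le> l\<^sub>g * (norm (z s - x s) + L * norm (z s - x s))" .
        qed
        also have "\<dots> = M * norm (z s - x s) + \<epsilon>" by (simp add: M_def algebra_simps)
        finally show ?thesis .
      qed
    qed (use q T M eps s in auto)
    also have "\<dots> = c * \<epsilon>" by (simp add: c_def)
    also have "\<dots> \<le> c * \<epsilon> * mittag_leffler q s"
      using mult_left_mono[OF mittag_leffler_ge_1[OF q(1), of s], of "c * \<epsilon>"] s c eps by simp
    finally show ?thesis .
  qed
  show ?thesis unfolding mlhu_stable_def using c stable by blast
qed

end
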